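(* Let $1<p<\infty$ and let $m$ be a positive integer. Define $Q^m:l_p\times l_p\to l_p$ by $Q^m(x,y)=\{(t_n^2+s_n)^m\}_{n=1}^\infty$ for $x=\{t_n\}_{n=1}^\infty$, $y=\{s_n\}_{n=1}^\infty\in l_p$. Then $Q^m$ is partially Fréchet differentiable on $l_p\times l_p$ with respect to each variable, and for any $(\bar x,\bar y)\in l_p\times l_p$ with $\bar x=(\bar t_1,\bar t_2,\dots)$ and $\bar y=(\bar s_1,\bar s_2,\dots)$: (i) the partial Fréchet derivative with respect to the first variable is $$\nabla_1(Q^m)(\bar x,\bar y)=\begin{pmatrix}2m\bar t_1(\bar t_1^2+\bar s_1)^{m-1}&0&\cdots\\0&2m\bar t_2(\bar t_2^2+\bar s_2)^{m-1}&0\\\vdots&0&\ddots\end{pmatrix};$$ more precisely, $\nabla_1(Q^m)(\bar x,\bar y)$ is a continuous linear operator on $l_p$ such that for any $v=\{t_n\}_{n=1}^\infty\in l_p$, $$\nabla_1(Q^m)(\bar x,\bar y)(v)=\{2m\bar t_n(\bar t_n^2+\bar s_n)^{m-1}t_n\}_{n=1}^\infty\in l_p;$$ (ii) the partial Fréchet derivative with respect to the second variable is $$\nabla_2(Q^m)(\bar x,\bar y)=\begin{pmatrix}m(\bar t_1^2+\bar s_1)^{m-1}&0&\cdots\\0&m(\bar t_2^2+\bar s_2)^{m-1}&0\\\vdots&0&\ddots\end{pmatrix};$$ more precisely, $\nabla_2(Q^m)(\bar x,\bar y)$ is a continuous linear operator on $l_p$ such that for any $u=\{s_n\}_{n=1}^\infty\in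 l_p$, $$\nabla_2(Q^m)(\bar x,\bar y)(u)=\{m(\bar t_n^2+\bar s_n)^{m-1}s_n\}_{n=1}^\infty\in l_p.$$
   Context: $l_p$ is the real sequence space with norm $\|\cdot\|_p$ and null element $\theta=(0,0,\dots)$. For $m=1$ the expression $(\cdot)^{m-1}$ equals $1$. A diagonal matrix with entries $d_n$ denotes the pointwise multiplication operator $\{t_n\}\mapsto\{d_nt_n\}$. A mapping $F:l_p\times l_p\to l_p$ is partially Fréchet differentiable with respect to the first variable at $(\bar x,\bar y)$ if there is a continuous linear mapping $\nabla_1F(\bar x,\bar y):l_p\to l_p$ with $\lim_{u\to\theta}\frac{F(\bar x+u,\bar y)-F(\bar x,\bar y)-\nabla_1F(\bar x,\bar y)(u)}{\|u\|_p}=\theta$; with respect to the second variable if there is a continuous linear mapping $\nabla_2F(\bar x,\bar y):l_p\to l_p$ with $\lim_{w\to\theta}\frac{F(\bar x,\bar y+w)-F(\bar x,\bar y)-\nabla_2F(\bar x,\bar y)(w)}{\|w\|_p}=\theta$. *)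

theory Defs
  imports "HOL-Analysis.Analysis"
begin

text \<open>Sequences are indexed from 0 instead of 1.  Since the exponent is a real parameter, the
  space is a carrier set with its own norm and topology and not an instance of the type classes.\<close>

definition lp :: "real \<Rightarrow> (nat \<Rightarrow> real) set" where
  "lp p = {x. summable (\<lambda>n. \<bar>x n\<bar> powr p)}"

definition lp_norm :: "real \<Rightarrow> (nat \<Rightarrow> real) \<Rightarrow> real" where
  "lp_norm p x = (\<Sum>n. \<bar>x n\<bar> powr p) powr (1 / p)"

definition lp_dist :: "real \<Rightarrow> (nat \<Rightarrow> real) \<Rightarrow> (nat \<Rightarrow> real) \<Rightarrow> real" where
  "lp_dist p x y = lp_norm p (\<lambda>n. x n - y n)"

definition lp_topology :: "real \<Rightarrow> (nat \<Rightarrow> real) topology" where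
  "lp_topology p = Metric_space.mtopology (lp p) (lp_dist p)"

text \<open>Operators on the space belong to the extensional function space \<open>\<rightarrow>\<^sub>E\<close>, so that two operators
  which agree on the carrier are equal as HOL functions.\<close>

definition lp_continuous_linear :: "real \<Rightarrow> ((nat \<Rightarrow> real) \<Rightarrow> (nat \<Rightarrow> real)) \<Rightarrow> bool" where
  "lp_continuous_linear p T \<longleftrightarrow>
     T \<in> lp p \<rightarrow>\<^sub>E lp p \<and>
     (\<forall>u\<in>lp p. \<forall>v\<in>lp p. T (\<lambda>n. u n + v n) = (\<lambda>n. T u n + T v n)) \<and>
     (\<forall>c. \<forall>u\<in>lp p. T (\<lambda>n. c * u n) = (\<lambda>n. c * T u n)) \<and>
     continuous_map (lp_topology p) (lp_topology p) T"

definition lp_diagonal :: "real \<Rightarrow> (nat \<Rightarrow> real) \<Rightarrow> (nat \<Rightarrow> real) \<Rightarrow> (nat \<Rightarrow> real)" where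
  "lp_diagonal p d = (\<lambda>v\<in>lp p. \<lambda>n. d n * v n)"

definition lp_has_partial1 ::
  "real \<Rightarrow> ((nat \<Rightarrow> real) \<times> (nat \<Rightarrow> real) \<Rightarrow> (nat \<Rightarrow> real)) \<Rightarrow> ((nat \<Rightarrow> real) \<Rightarrow> (nat \<Rightarrow> real)) \<Rightarrow>
    (nat \<Rightarrow> real) \<Rightarrow> (nat \<Rightarrow> real) \<Rightarrow> bool" where
  "lp_has_partial1 p F T x y \<longleftrightarrow>
     lp_continuous_linear p T \<and>
     limitin (lp_topology p)
       (\<lambda>u. \<lambda>n. (F (\<lambda>k. x k + u k, y) n - F (x, y) n - T u n) / lp_norm p u)
       (\<lambda>_. 0) (atin (lp_topology p) (\<lambda>_. 0))"

definition lp_has_partial2 ::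
  "real \<Rightarrow> ((nat \<Rightarrow> real) \<times> (nat \<Rightarrow> real) \<Rightarrow> (nat \<Rightarrow> real)) \<Rightarrow> ((nat \<Rightarrow> real) \<Rightarrow> (nat \<Rightarrow> real)) \<Rightarrow>
    (nat \<Rightarrow> real) \<Rightarrow> (nat \<Rightarrow> real) \<Rightarrow> bool" where
  "lp_has_partial2 p F T x y \<longleftrightarrow>
     lp_continuous_linear p T \<and>
     limitin (lp_topology p)
       (\<lambda>w. \<lambda>n. (F (x, \<lambda>k. y k + w k) n - F (x, y) n - T w n) / lp_norm p w)
       (\<lambda>_. 0) (atin (lp_topology p) (\<lambda>_. 0))"

definition lp_partially_differentiable1 where
  "lp_partially_differentiable1 p F x y \<longleftrightarrow> (\<exists>T. lp_has_partial1 p F T x y)"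

definition lp_partially_differentiable2 where
  "lp_partially_differentiable2 p F x y \<longleftrightarrow> (\<exists>T. lp_has_partial2 p F T x y)"

definition lp_nabla1 where
  "lp_nabla1 p F x y = (THE T. lp_has_partial1 p F T x y)"

definition lp_nabla2 where
  "lp_nabla2 p F x y = (THE T. lp_has_partial2 p F T x y)"

definition Qpow :: "nat \<Rightarrow> (nat \<Rightarrow> real) \<times> (nat \<Rightarrow> real) \<Rightarrow> (nat \<Rightarrow> real)" where
  "Qpow m = (\<lambda>(x, y). \<lambda>n. ((x n)\<^sup>2 + y n) ^ m)"

text \<open>Minkowski's inequality shows that \<open>lp_topology\<close> is the topology of a metric space.\<close>

lemma powr_convex_nonneg:
  fixes p :: real
  assumes "p \<ge> 1" "0 \<le> t" "t \<le> 1" "0 \<le> a" "0 \<le> b"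
  shows "((1 - t) * a + t * b) powr p \<le> (1 - t) * a powr p + t * b powr p"
proof -
  have scale: "(s * c) powr p \<le> s * c powr p" if "0 \<le> s" "s \<le> 1" "0 \<le> c" for s c :: real
  proof -
    have "s powr p \<le> s"
      using powr_mono'[of 1 p s] that assms(1) by simp
    then show ?thesis
      using that by (simp add: powr_mult mult_right_mono)
  qed
  consider "a = 0" | "b = 0" | "a > 0" "b > 0"
    using assms by linarith
  then show ?thesis
  proof cases
    case 1 then show ?thesis using scale[of t b] assms by simp
  next
    case 2 then show ?thesis using scale[of "1 - t" a] assms by simp
  next
    case 3 then show ?thesis
      using convex_onD[OF powr_convex[OF assms(1)], of t a b] assms by simp
  qed
qed

lemma lp_norm_nonneg: "0 \<le> lp_norm p x"
  by (simp add: lp_norm_def)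

lemma lp_norm_powr:
  assumes "p \<ge> 1" "x \<in> lp p"
  shows "lp_norm p x powr p = (\<Sum>n. \<bar>x n\<bar> powr p)"
  using assms by (simp add: lp_norm_def lp_def powr_powr suminf_nonneg)

lemma lp_norm_eq_0_iff:
  assumes "p \<ge> 1" "x \<in> lp p"
  shows "lp_norm p x = 0 \<longleftrightarrow> x = (\<lambda>_. 0)"
  using assms suminf_eq_zero_iff[of "\<lambda>n. \<bar>x n\<bar> powr p"]
  by (auto simp: lp_norm_def lp_def)

lemma lp_norm_uminus: "lp_norm p (\<lambda>n. - x n) = lp_norm p x"
  by (simp add: lp_norm_def)

lemma lp_minkowski:
  assumes p: "p \<ge> 1" and x: "x \<in> lp p" and y: "y \<in> lp p"
  shows "(\<lambda>n. x n + y n) \<in> lp p \<and> lp_norm p (\<lambda>n. x n + y n) \<le> lp_norm p x + lp_norm p y"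
proof -
  let ?a = "lp_norm p x" and ?b = "lp_norm p y"
  consider "?a = 0" | "?b = 0" | "?a > 0" "?b > 0"
    using lp_norm_nonneg[of p x] lp_norm_nonneg[of p y] by linarith
  then show ?thesis
  proof cases
    case 1 then show ?thesis using lp_norm_eq_0_iff[OF p x] x y by (simp add: lp_norm_nonneg)
  next
    case 2 then show ?thesis using lp_norm_eq_0_iff[OF p y] x y by (simp add: lp_norm_nonneg)
  next
    case 3
    define c where "c = ?a + ?b"
    define t where "t = ?b / c"
    have c: "c > 0" and t: "0 \<le> t" "t \<le> 1" and t': "1 - t = ?a / c"
      using 3 by (auto simp: c_def t_def field_simps)
    have sx: "summable (\<lambda>n. \<bar>x n\<bar> powr p)" and sy: "summable (\<lambda>n. \<bar>y n\<bar> powr p)"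
      using x y by (auto simp: lp_def)
    define g where "g = (\<lambda>n. c powr p * ((1 - t) / ?a powr p * \<bar>x n\<bar> powr p
                                       + t / ?b powr p * \<bar>y n\<bar> powr p))"
    have le: "\<bar>x n + y n\<bar> powr p \<le> g n" for n
    proof -
      have "\<bar>x n\<bar> + \<bar>y n\<bar> = c * ((1 - t) * (\<bar>x n\<bar> / ?a) + t * (\<bar>y n\<bar> / ?b))"
        unfolding t' unfolding t_def using 3 c by (simp add: field_simps)
      then have "\<bar>x n + y n\<bar> \<le> c * ((1 - t) * (\<bar>x n\<bar> / ?a) + t * (\<bar>y n\<bar> / ?b))"
        using abs_triangle_ineq[of "x n" "y n"] by linarith
      then have "\<bar>x n + y n\<bar> powr p \<le> (c * ((1 - t) * (\<bar>x n\<bar> / ?a) + t * (\<bar>y n\<bar> / ?b))) powr p"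
        using p by (intro powr_mono2) auto
      also have "\<dots> = c powr p * ((1 - t) * (\<bar>x n\<bar> / ?a) + t * (\<bar>y n\<bar> / ?b)) powr p"
        using 3 c t by (intro powr_mult)
      also have "\<dots> \<le> c powr p * ((1 - t) * (\<bar>x n\<bar> / ?a) powr p + t * (\<bar>y n\<bar> / ?b) powr p)"
        using 3 p t by (intro mult_left_mono powr_convex_nonneg) auto
      also have "\<dots> = g n"
        using 3 by (simp add: g_def powr_divide)
      finally show ?thesis .
    qed
    have sg: "summable g"
      unfolding g_def by (intro summable_mult summable_add sx sy)
    have "suminf g = c powr p * ((1 - t) / ?a powr p * (\<Sum>n. \<bar>x n\<bar> powr p)
                                + t / ?b powr p * (\<Sum>n. \<bar>y n\<bar> powr p))"
      unfolding g_def
      by (intro sums_unique[symmetric] sums_mult sums_add summable_sums sx sy)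
    also have "\<dots> = c powr p"
      using 3 by (simp add: lp_norm_powr[OF p x, symmetric] lp_norm_powr[OF p y, symmetric])
    finally have gsum: "suminf g = c powr p" .
    have s: "summable (\<lambda>n. \<bar>x n + y n\<bar> powr p)"
      by (rule summable_comparison_test'[OF sg, of 0]) (use le in auto)
    have "(\<Sum>n. \<bar>x n + y n\<bar> powr p) \<le> c powr p"
      using suminf_le[OF le s sg] gsum by simp
    then have "lp_norm p (\<lambda>n. x n + y n) \<le> (c powr p) powr (1 / p)"
      unfolding lp_norm_def using p s by (intro powr_mono2) (auto intro: suminf_nonneg)
    also have "\<dots> = c"
      using p c by (simp add: powr_powr)
    finally show ?thesis
      using s by (simp add: lp_def c_def)
  qed
qed

lemma lp_uminus: "x \<in> lp p \<Longrightarrow> (\<lambda>n. - x n) \<in> lp p"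
  by (simp add: lp_def)

lemma lp_diff:
  assumes "p \<ge> 1" "x \<in> lp p" "y \<in> lp p"
  shows "(\<lambda>n. x n - y n) \<in> lp p"
  using lp_minkowski[OF assms(1,2) lp_uminus[OF assms(3)]] by simp

lemma Metric_space_lp:
  assumes p: "p \<ge> 1"
  shows "Metric_space (lp p) (lp_dist p)"
proof
  fix x y z
  show "0 \<le> lp_dist p x y"
    by (simp add: lp_dist_def lp_norm_nonneg)
  show "lp_dist p x y = lp_dist p y x"
    by (simp add: lp_dist_def lp_norm_def abs_minus_commute)
  assume x: "x \<in> lp p" and y: "y \<in> lp p"
  show "lp_dist p x y = 0 \<longleftrightarrow> x = y"
    using lp_norm_eq_0_iff[OF p lp_diff[OF p x y]] by (auto simp: lp_dist_def fun_eq_iff)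
  assume z: "z \<in> lp p"
  show "lp_dist p x z \<le> lp_dist p x y + lp_dist p y z"
    using lp_minkowski[OF p lp_diff[OF p x y] lp_diff[OF p y z]] by (simp add: lp_dist_def)
qed

end

theory Submission
  imports Defs
begin

text \<open>The operator \<open>Qpow m\<close> acts coordinate by coordinate, and its derivative at a point is read off
  from the scalar function \<open>z ^ m\<close> together with \<open>z = t\<^sup>2 + s\<close>.  What has to be shown is that the scalar
  linearisations fit together uniformly over all coordinates.  They do because a \<open>p\<close>-summable sequence
  is bounded by its norm (\<open>abs_le_lp_norm\<close>): the base points \<open>(x n, y n)\<close> stay in a fixed bounded
  set, where the second order Taylor remainder of a polynomial is at most a constant \<open>C\<close> times the
  square of the increment (\<open>power_taylor_remainder\<close>).

  A remainder sequence \<open>r\<close> with \<open>\<bar>r n\<bar> \<le> C * (u n)\<^sup>2\<close> satisfies \<open>\<bar>r n\<bar> \<le> C * \<parallel>u\<parallel> * \<bar>u n\<bar>\<close> by the same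
  bound, hence \<open>\<parallel>r\<parallel> \<le> C * \<parallel>u\<parallel>\<^sup>2\<close>, which is Frechet differentiability
  (\<open>limitin_quadratic_remainder\<close>).  The same domination argument shows that multiplication by a bounded
  sequence is a continuous operator (\<open>lp_continuous_linear_diagonal\<close>).  Finally a first order
  approximation determines its linear part (\<open>lp_linearisation_unique\<close>), so that the derivatives
  found in this way are the values of \<open>lp_nabla1\<close> and \<open>lp_nabla2\<close>.\<close>

section \<open>Domination in the sequence space\<close>

lemma lp_zero: "(\<lambda>_. 0) \<in> lp p"
  by (simp add: lp_def)

lemma abs_le_lp_norm:
  assumes "p \<ge> 1" "x \<in> lp p"
  shows "\<bar>x n\<bar> \<le> lp_norm p x"
proof -
  have "\<bar>x n\<bar> powr p \<le> (\<Sum>n. \<bar>x n\<bar> powr p)"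
    using assms sum_le_suminf[of "\<lambda>n. \<bar>x n\<bar> powr p" "{n}"] by (auto simp: lp_def)
  then have "(\<bar>x n\<bar> powr p) powr (1 / p) \<le> lp_norm p x"
    unfolding lp_norm_def using assms by (intro powr_mono2) auto
  then show ?thesis
    using assms by (simp add: powr_powr)
qed

lemma lp_dominated:
  assumes p: "p \<ge> 1" and u: "u \<in> lp p" and C: "C \<ge> 0" and le: "\<And>n. \<bar>w n\<bar> \<le> C * \<bar>u n\<bar>"
  shows "w \<in> lp p" and "lp_norm p w \<le> C * lp_norm p u"
proof -
  have le': "\<bar>w n\<bar> powr p \<le> C powr p * \<bar>u n\<bar> powr p" for n
    using powr_mono2[OF _ _ le[of n], of p] p C by (simp add: powr_mult)
  have su: "summable (\<lambda>n. \<bar>u n\<bar> powr p)"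
    using u by (simp add: lp_def)
  then have s: "summable (\<lambda>n. C powr p * \<bar>u n\<bar> powr p)"
    by (rule summable_mult)
  have sw: "summable (\<lambda>n. \<bar>w n\<bar> powr p)"
    by (rule summable_comparison_test'[OF s, of 0]) (use le' in auto)
  then show "w \<in> lp p"
    by (simp add: lp_def)
  have "(\<Sum>n. \<bar>w n\<bar> powr p) \<le> C powr p * (\<Sum>n. \<bar>u n\<bar> powr p)"
    using suminf_le[OF le' sw s] suminf_mult[OF su] by simp
  then have "lp_norm p w \<le> (C powr p * (\<Sum>n. \<bar>u n\<bar> powr p)) powr (1 / p)"
    unfolding lp_norm_def using p sw by (intro powr_mono2) (auto intro: suminf_nonneg)
  also have "\<dots> = C * lp_norm p u"
    using p C su by (simp add: lp_norm_def powr_mult powr_powr suminf_nonneg)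
  finally show "lp_norm p w \<le> C * lp_norm p u" .
qed

lemma lp_bounded_mult:
  assumes "p \<ge> 1" "u \<in> lp p" "\<And>n. \<bar>d n\<bar> \<le> B"
  shows "(\<lambda>n. d n * u n) \<in> lp p"
proof (rule lp_dominated(1)[OF assms(1,2)])
  show "B \<ge> 0"
    using assms(3)[of 0] by linarith
  show "\<bar>d n * u n\<bar> \<le> B * \<bar>u n\<bar>" for n
    using assms(3) by (simp add: abs_mult mult_right_mono)
qed

lemma lp_norm_scale:
  assumes "p \<ge> 1" "u \<in> lp p" "c > 0"
  shows "lp_norm p (\<lambda>n. c * u n) = c * lp_norm p u"
  using assms by (simp add: lp_norm_def lp_def abs_mult powr_mult powr_powr suminf_mult suminf_nonneg)

section \<open>Operators and first order approximations\<close>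

lemma lp_continuous_linear_diagonal:
  assumes p: "p \<ge> 1" and d: "\<And>n. \<bar>d n\<bar> \<le> B"
  shows "lp_continuous_linear p (lp_diagonal p d)"
proof -
  interpret Metric_space "lp p" "lp_dist p"
    by (rule Metric_space_lp[OF p])
  have B: "B \<ge> 0"
    using d[of 0] by linarith
  have mem: "(\<lambda>n. d n * v n) \<in> lp p" if "v \<in> lp p" for v
    by (rule lp_bounded_mult[OF p that d])
  have lipschitz: "lp_dist p (\<lambda>n. d n * x n) (\<lambda>n. d n * y n) \<le> B * lp_dist p x y"
    if "x \<in> lp p" "y \<in> lp p" for x y
    unfolding lp_dist_def
  proof (rule lp_dominated(2)[OF p lp_diff[OF p that] B])
    show "\<bar>d n * x n - d n * y n\<bar> \<le> B * \<bar>x n - y n\<bar>" for n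
      using d by (simp add: abs_mult mult_right_mono flip: right_diff_distrib)
  qed
  have "\<exists>\<delta>>0. \<forall>x. x \<in> lp p \<and> lp_dist p a x < \<delta> \<longrightarrow>
          lp_dist p (lp_diagonal p d a) (lp_diagonal p d x) < \<epsilon>"
    if "a \<in> lp p" "\<epsilon> > 0" for a \<epsilon>
  proof (intro exI conjI allI impI)
    \<comment> \<open>\<open>B + 1\<close> avoids a division by zero for the zero operator.\<close>
    show "\<epsilon> / (B + 1) > 0"
      using that B by simp
    fix x assume x: "x \<in> lp p \<and> lp_dist p a x < \<epsilon> / (B + 1)"
    have "B * lp_dist p a x \<le> (B + 1) * lp_dist p a x"
      by (intro mult_right_mono) auto
    also have "\<dots> < \<epsilon>"
      using x B by (simp add: field_simps)
    finally show "lp_dist p (lp_diagonal p d a) (lp_diagonal p d x) < \<epsilon>"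
      using lipschitz[of a x] that x by (simp add: lp_diagonal_def)
  qed
  then have "continuous_map (lp_topology p) (lp_topology p) (lp_diagonal p d)"
    unfolding lp_topology_def
    by (subst metric_continuous_map[OF Metric_space_axioms]) (auto simp: lp_diagonal_def mem)
  moreover have "(\<lambda>n. c * u n) \<in> lp p" if "u \<in> lp p" for c u
    using lp_bounded_mult[OF p that, of "\<lambda>_. c" "\<bar>c\<bar>"] by simp
  ultimately show ?thesis
    using lp_minkowski[OF p]
    by (auto simp: lp_continuous_linear_def lp_diagonal_def mem distrib_left mult.left_commute)
qed

text \<open>Both partial derivatives are defined by a limit of this form.  The condition \<open>0 < lp_norm p u\<close>
  keeps the quotients by \<open>lp_norm p u\<close> away from division by zero.\<close>

lemma limitin_lp_zero_iff:
  assumes p: "p \<ge> 1"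
  shows "limitin (lp_topology p) f (\<lambda>_. 0) (atin (lp_topology p) (\<lambda>_. 0)) \<longleftrightarrow>
    (\<forall>\<epsilon>>0. \<exists>\<delta>>0. \<forall>u\<in>lp p. 0 < lp_norm p u \<and> lp_norm p u < \<delta> \<longrightarrow>
        f u \<in> lp p \<and> lp_norm p (f u) < \<epsilon>)"
proof -
  interpret Metric_space "lp p" "lp_dist p"
    by (rule Metric_space_lp[OF p])
  have [simp]: "lp_dist p u (\<lambda>_. 0) = lp_norm p u" for u
    by (simp add: lp_dist_def)
  show ?thesis
    unfolding lp_topology_def limitin_metric eventually_atin_metric
    by (simp add: lp_zero Ball_def imp_conjL)
qed

text \<open>A remainder that is quadratic in every coordinate, with one constant, is quadratic in norm, since
  \<open>(u n)\<^sup>2 \<le> \<parallel>u\<parallel> * \<bar>u n\<bar>\<close>.  The estimate on the unit ball is enough because the limit only sees small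
  \<open>u\<close>; the remainder of a polynomial of degree above two outgrows every quadratic bound
  for large \<open>u\<close>.\<close>

lemma limitin_quadratic_remainder:
  assumes p: "p \<ge> 1" and C: "C \<ge> 0"
    and le: "\<And>u n. u \<in> lp p \<Longrightarrow> lp_norm p u < 1 \<Longrightarrow> \<bar>R u n\<bar> \<le> C * (u n)\<^sup>2"
  shows "limitin (lp_topology p) (\<lambda>u n. R u n / lp_norm p u) (\<lambda>_. 0)
           (atin (lp_topology p) (\<lambda>_. 0))"
  unfolding limitin_lp_zero_iff[OF p]
proof (intro allI impI)
  fix \<epsilon> :: real assume \<epsilon>: "\<epsilon> > 0"
  show "\<exists>\<delta>>0. \<forall>u\<in>lp p. 0 < lp_norm p u \<and> lp_norm p u < \<delta> \<longrightarrow>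
      (\<lambda>n. R u n / lp_norm p u) \<in> lp p \<and> lp_norm p (\<lambda>n. R u n / lp_norm p u) < \<epsilon>"
  proof (intro exI conjI ballI impI)
    let ?\<delta> = "min 1 (\<epsilon> / (C + 1))"
    show "?\<delta> > 0"
      using \<epsilon> C by simp
    fix u assume u: "u \<in> lp p" and small: "0 < lp_norm p u \<and> lp_norm p u < ?\<delta>"
    have dom: "\<bar>R u n / lp_norm p u\<bar> \<le> C * \<bar>u n\<bar>" for n
    proof -
      have "\<bar>R u n\<bar> \<le> C * (\<bar>u n\<bar> * \<bar>u n\<bar>)"
        using le[OF u, of n] small by (simp add: power2_eq_square)
      also have "\<dots> \<le> C * (\<bar>u n\<bar> * lp_norm p u)"
        using C abs_le_lp_norm[OF p u] by (intro mult_left_mono) auto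
      finally show ?thesis
        using small by (simp add: field_simps)
    qed
    show "(\<lambda>n. R u n / lp_norm p u) \<in> lp p"
      by (rule lp_dominated(1)[OF p u C dom])
    have "lp_norm p (\<lambda>n. R u n / lp_norm p u) \<le> C * lp_norm p u"
      by (rule lp_dominated(2)[OF p u C dom])
    also have "\<dots> \<le> (C + 1) * lp_norm p u"
      by (intro mult_right_mono) (auto simp: lp_norm_nonneg)
    also have "\<dots> < \<epsilon>"
      using small C by (simp add: field_simps)
    finally show "lp_norm p (\<lambda>n. R u n / lp_norm p u) < \<epsilon>" .
  qed
qed

text \<open>Two linear parts of the same increment \<open>G\<close> differ in each coordinate by at most \<open>\<epsilon> * \<parallel>u\<parallel>\<close> for
  small \<open>u\<close>.  By homogeneity the estimate holds for every \<open>u\<close>, so the difference vanishes.\<close>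

lemma lp_linearisation_unique:
  assumes p: "p \<ge> 1"
    and S: "lp_continuous_linear p S" and T: "lp_continuous_linear p T"
    and limS: "limitin (lp_topology p) (\<lambda>u n. (G u n - S u n) / lp_norm p u) (\<lambda>_. 0)
                 (atin (lp_topology p) (\<lambda>_. 0))"
    and limT: "limitin (lp_topology p) (\<lambda>u n. (G u n - T u n) / lp_norm p u) (\<lambda>_. 0)
                 (atin (lp_topology p) (\<lambda>_. 0))"
  shows "S = T"
proof (rule extensionalityI[of _ "lp p"])
  show "S \<in> extensional (lp p)" "T \<in> extensional (lp p)"
    using S T by (auto simp: lp_continuous_linear_def PiE_def)
  fix v assume v: "v \<in> lp p"
  have hom: "S (\<lambda>n. c * v n) = (\<lambda>n. c * S v n)" "T (\<lambda>n. c * v n) = (\<lambda>n. c * T v n)" for c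
    using S T v by (auto simp: lp_continuous_linear_def)
  show "S v = T v"
  proof (cases "lp_norm p v = 0")
    case True
    then have "v = (\<lambda>n. 0 * v n)"
      using lp_norm_eq_0_iff[OF p v] by simp
    then show ?thesis
      using hom[of 0] by simp
  next
    case False
    then have nv: "lp_norm p v > 0"
      using lp_norm_nonneg[of p v] by linarith
    have "\<bar>S v n - T v n\<bar> \<le> 0 + e" if e: "e > 0" for n e
    proof -
      define \<epsilon> where "\<epsilon> = e / (2 * lp_norm p v)"
      have \<epsilon>: "\<epsilon> > 0"
        using e nv by (simp add: \<epsilon>_def)
      obtain \<delta>1 where \<delta>1: "\<delta>1 > 0" "\<And>u. u \<in> lp p \<Longrightarrow> 0 < lp_norm p u \<Longrightarrow> lp_norm p u < \<delta>1 \<Longrightarrow>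
          (\<lambda>n. (G u n - S u n) / lp_norm p u) \<in> lp p \<and>
          lp_norm p (\<lambda>n. (G u n - S u n) / lp_norm p u) < \<epsilon>"
        using limS \<epsilon> unfolding limitin_lp_zero_iff[OF p] by meson
      obtain \<delta>2 where \<delta>2: "\<delta>2 > 0" "\<And>u. u \<in> lp p \<Longrightarrow> 0 < lp_norm p u \<Longrightarrow> lp_norm p u < \<delta>2 \<Longrightarrow>
          (\<lambda>n. (G u n - T u n) / lp_norm p u) \<in> lp p \<and>
          lp_norm p (\<lambda>n. (G u n - T u n) / lp_norm p u) < \<epsilon>"
        using limT \<epsilon> unfolding limitin_lp_zero_iff[OF p] by meson
      define c where "c = min \<delta>1 \<delta>2 / (2 * lp_norm p v)"
      define u where "u = (\<lambda>n. c * v n)"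
      have c: "c > 0"
        using \<delta>1(1) \<delta>2(1) nv by (simp add: c_def)
      have u: "u \<in> lp p"
        unfolding u_def by (rule lp_bounded_mult[OF p v, of _ c]) (use c in simp)
      have nu: "lp_norm p u = c * lp_norm p v"
        unfolding u_def by (rule lp_norm_scale[OF p v c])
      have "c * lp_norm p v = min \<delta>1 \<delta>2 / 2"
        using nv by (simp add: c_def)
      then have small: "0 < lp_norm p u" "lp_norm p u < \<delta>1" "lp_norm p u < \<delta>2"
        using \<delta>1(1) \<delta>2(1) nu by linarith+
      have "\<bar>(G u n - S u n) / lp_norm p u\<bar> < \<epsilon>" "\<bar>(G u n - T u n) / lp_norm p u\<bar> < \<epsilon>"
        using \<delta>1(2)[OF u small(1,2)] \<delta>2(2)[OF u small(1,3)]
          abs_le_lp_norm[OF p, of "\<lambda>n. (G u n - S u n) / lp_norm p u" n]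
          abs_le_lp_norm[OF p, of "\<lambda>n. (G u n - T u n) / lp_norm p u" n]
        by linarith+
      then have "\<bar>G u n - S u n\<bar> < \<epsilon> * lp_norm p u" "\<bar>G u n - T u n\<bar> < \<epsilon> * lp_norm p u"
        using small(1) by (simp_all add: field_simps)
      then have "\<bar>S u n - T u n\<bar> \<le> 2 * \<epsilon> * lp_norm p u"
        by linarith
      then have "c * \<bar>S v n - T v n\<bar> \<le> c * e"
        using c nv by (simp add: u_def hom nu[unfolded u_def] \<epsilon>_def abs_mult
            flip: right_diff_distrib)
      then show ?thesis
        using c by simp
    qed
    then have "\<bar>S v n - T v n\<bar> \<le> 0" for n
      by (rule field_le_epsilon)
    then show ?thesis
      by (auto simp: fun_eq_iff)
  qed
qed

lemma lp_nabla1_eqI: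
  assumes "p \<ge> 1" "lp_has_partial1 p F T x y"
  shows "lp_nabla1 p F x y = T"
  unfolding lp_nabla1_def
proof (rule the_equality, rule assms(2))
  show "S = T" if "lp_has_partial1 p F S x y" for S
    by (rule lp_linearisation_unique[OF assms(1),
          where G = "\<lambda>u n. F (\<lambda>k. x k + u k, y) n - F (x, y) n"])
      (use that assms(2) in \<open>auto simp: lp_has_partial1_def\<close>)
qed

lemma lp_nabla2_eqI:
  assumes "p \<ge> 1" "lp_has_partial2 p F T x y"
  shows "lp_nabla2 p F x y = T"
  unfolding lp_nabla2_def
proof (rule the_equality, rule assms(2))
  show "S = T" if "lp_has_partial2 p F S x y" for S
    by (rule lp_linearisation_unique[OF assms(1),
          where G = "\<lambda>w n. F (x, \<lambda>k. y k + w k) n - F (x, y) n"])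
      (use that assms(2) in \<open>auto simp: lp_has_partial2_def\<close>)
qed

section \<open>The power operator\<close>

text \<open>The remainder \<open>R\<^sub>m\<close> of \<open>z ^ m\<close> satisfies
  \<open>R\<^sub>m\<^sub>+\<^sub>1 = (z + k) * R\<^sub>m + m * z ^ (m - 1) * k\<^sup>2\<close>, so induction on the exponent gives a
  constant that depends only on \<open>m\<close> and the bound \<open>B\<close>, not on the base point.\<close>

lemma power_taylor_remainder:
  fixes B :: real
  assumes B: "B \<ge> 0"
  shows "\<exists>C\<ge>0. \<forall>z k. \<bar>z\<bar> \<le> B \<longrightarrow> \<bar>k\<bar> \<le> B \<longrightarrow>
           \<bar>(z + k) ^ m - z ^ m - real m * z ^ (m - 1) * k\<bar> \<le> C * k\<^sup>2"
proof (induction m)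
  case 0
  show ?case by (intro exI[of _ 0]) auto
next
  case (Suc m)
  then obtain C where C: "C \<ge> 0" and le: "\<And>z k. \<bar>z\<bar> \<le> B \<Longrightarrow> \<bar>k\<bar> \<le> B \<Longrightarrow>
      \<bar>(z + k) ^ m - z ^ m - real m * z ^ (m - 1) * k\<bar> \<le> C * k\<^sup>2"
    by auto
  show ?case
  proof (intro exI conjI allI impI)
    show "0 \<le> 2 * B * C + real m * B ^ (m - 1)"
      using B C by simp
    fix z k :: real assume z: "\<bar>z\<bar> \<le> B" and k: "\<bar>k\<bar> \<le> B"
    let ?r = "(z + k) ^ m - z ^ m - real m * z ^ (m - 1) * k"
    have "(z + k) ^ Suc m - z ^ Suc m - real (Suc m) * z ^ (Suc m - 1) * k
        = (z + k) * ?r + real m * z ^ (m - 1) * k\<^sup>2"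
      by (cases m) (simp_all add: algebra_simps power2_eq_square)
    also have "\<bar>\<dots>\<bar> \<le> \<bar>(z + k) * ?r\<bar> + \<bar>real m * z ^ (m - 1) * k\<^sup>2\<bar>"
      by (rule abs_triangle_ineq)
    also have "\<bar>(z + k) * ?r\<bar> \<le> (2 * B) * (C * k\<^sup>2)"
      unfolding abs_mult using le[OF z k] z k B by (intro mult_mono) auto
    also have "\<bar>real m * z ^ (m - 1) * k\<^sup>2\<bar> \<le> real m * B ^ (m - 1) * k\<^sup>2"
      using z by (auto simp: abs_mult power_abs intro!: mult_right_mono mult_left_mono power_mono)
    finally show "\<bar>(z + k) ^ Suc m - z ^ Suc m - real (Suc m) * z ^ (Suc m - 1) * k\<bar>
        \<le> (2 * B * C + real m * B ^ (m - 1)) * k\<^sup>2"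
      by (simp add: algebra_simps)
  qed
qed

lemma lp_square_plus:
  assumes p: "p \<ge> 1" and x: "x \<in> lp p" and y: "y \<in> lp p"
  shows "(\<lambda>n. (x n)\<^sup>2 + y n) \<in> lp p"
  using lp_minkowski[OF p lp_bounded_mult[OF p x abs_le_lp_norm[OF p x]] y]
  by (simp add: power2_eq_square)

lemma abs_power_le_lp_norm:
  assumes "p \<ge> 1" "z \<in> lp p"
  shows "\<bar>z n ^ k\<bar> \<le> lp_norm p z ^ k"
  unfolding power_abs using abs_le_lp_norm[OF assms] by (intro power_mono) auto

lemma Qpow_in_lp:
  assumes p: "p \<ge> 1" and m: "m \<ge> 1" and x: "x \<in> lp p" and y: "y \<in> lp p"
  shows "Qpow m (x, y) \<in> lp p"
proof -
  \<comment> \<open>Only \<open>m - 1\<close> factors may be treated as a bounded multiplier; the remaining one supplies the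
    summability, which is lost for \<open>m = 0\<close>.\<close>
  have "((x n)\<^sup>2 + y n) ^ m = ((x n)\<^sup>2 + y n) ^ (m - 1) * ((x n)\<^sup>2 + y n)" for n
    using m by (cases m) auto
  then show ?thesis
    using lp_bounded_mult[OF p lp_square_plus[OF p x y]
        abs_power_le_lp_norm[OF p lp_square_plus[OF p x y]]]
    by (simp add: Qpow_def)
qed

lemma Qpow_has_partial2:
  assumes p: "p \<ge> 1" and x: "x \<in> lp p" and y: "y \<in> lp p"
  shows "lp_has_partial2 p (Qpow m) (lp_diagonal p (\<lambda>n. real m * ((x n)\<^sup>2 + y n) ^ (m - 1))) x y"
proof -
  define z where "z = (\<lambda>n. (x n)\<^sup>2 + y n)"
  have z: "z \<in> lp p"
    unfolding z_def by (rule lp_square_plus[OF p x y])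
  let ?d = "\<lambda>n. real m * z n ^ (m - 1)"
  \<comment> \<open>Bounds the base points \<open>z n\<close> and all increments from the unit ball.\<close>
  let ?B = "max (lp_norm p z) 1"
  have B: "?B \<ge> 0"
    using lp_norm_nonneg[of p z] by (simp add: le_max_iff_disj)
  obtain C where C: "C \<ge> 0" and le: "\<And>z k. \<bar>z\<bar> \<le> ?B \<Longrightarrow> \<bar>k\<bar> \<le> ?B \<Longrightarrow>
      \<bar>(z + k) ^ m - z ^ m - real m * z ^ (m - 1) * k\<bar> \<le> C * k\<^sup>2"
    using power_taylor_remainder[OF B, of m] by blast
  have "\<bar>?d n\<bar> \<le> real m * lp_norm p z ^ (m - 1)" for n
    using abs_power_le_lp_norm[OF p z] by (simp add: abs_mult mult_left_mono)
  then have "lp_continuous_linear p (lp_diagonal p ?d)"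
    by (rule lp_continuous_linear_diagonal[OF p])
  moreover have "limitin (lp_topology p)
      (\<lambda>w n. (Qpow m (x, \<lambda>k. y k + w k) n - Qpow m (x, y) n - lp_diagonal p ?d w n) / lp_norm p w)
      (\<lambda>_. 0) (atin (lp_topology p) (\<lambda>_. 0))"
  proof (rule limitin_quadratic_remainder[OF p C])
    fix w n assume w: "w \<in> lp p" and "lp_norm p w < 1"
    then have "\<bar>w n\<bar> \<le> ?B" "\<bar>z n\<bar> \<le> ?B"
      using abs_le_lp_norm[OF p w, of n] abs_le_lp_norm[OF p z, of n] by linarith+
    from le[OF this(2,1)]
    show "\<bar>Qpow m (x, \<lambda>k. y k + w k) n - Qpow m (x, y) n - lp_diagonal p ?d w n\<bar> \<le> C * (w n)\<^sup>2"
      using w by (simp add: Qpow_def lp_diagonal_def z_def add.assoc)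
  qed
  ultimately show ?thesis
    by (simp add: lp_has_partial2_def z_def)
qed

text \<open>Moving \<open>x n\<close> by \<open>h\<close> moves \<open>z = (x n)\<^sup>2 + y n\<close> by \<open>k = 2 * x n * h + h\<^sup>2\<close>.  The part of
  \<open>m * z ^ (m - 1) * k\<close> coming from \<open>h\<^sup>2\<close> is not linear in \<open>h\<close> and joins the remainder.\<close>

lemma Qpow_has_partial1:
  assumes p: "p \<ge> 1" and x: "x \<in> lp p" and y: "y \<in> lp p"
  shows "lp_has_partial1 p (Qpow m)
    (lp_diagonal p (\<lambda>n. 2 * real m * x n * ((x n)\<^sup>2 + y n) ^ (m - 1))) x y"
proof -
  define z where "z = (\<lambda>n. (x n)\<^sup>2 + y n)"
  have z: "z \<in> lp p"
    unfolding z_def by (rule lp_square_plus[OF p x y])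
  let ?d = "\<lambda>n. 2 * real m * x n * z n ^ (m - 1)"
  \<comment> \<open>An upper bound for \<open>\<bar>2 * x n + h\<bar>\<close> with \<open>\<bar>h\<bar> \<le> 1\<close>, hence for \<open>\<bar>k\<bar> / \<bar>h\<bar>\<close>.\<close>
  define A where "A = 2 * lp_norm p x + 1"
  have A: "A \<ge> 0"
    using lp_norm_nonneg[of p x] by (simp add: A_def)
  let ?B = "max (lp_norm p z) A"
  have B: "?B \<ge> 0"
    using A by (simp add: le_max_iff_disj)
  obtain C where C: "C \<ge> 0" and le: "\<And>z k. \<bar>z\<bar> \<le> ?B \<Longrightarrow> \<bar>k\<bar> \<le> ?B \<Longrightarrow>
      \<bar>(z + k) ^ m - z ^ m - real m * z ^ (m - 1) * k\<bar> \<le> C * k\<^sup>2"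
    using power_taylor_remainder[OF B, of m] by blast
  define D where "D = real m * lp_norm p z ^ (m - 1)"
  have D: "D \<ge> 0"
    by (simp add: D_def lp_norm_nonneg)
  have leD: "\<bar>real m * z n ^ (m - 1)\<bar> \<le> D" for n
    using abs_power_le_lp_norm[OF p z] by (simp add: D_def abs_mult mult_left_mono)
  have "\<bar>?d n\<bar> \<le> 2 * lp_norm p x * D" for n
  proof -
    have "\<bar>?d n\<bar> = 2 * \<bar>x n\<bar> * \<bar>real m * z n ^ (m - 1)\<bar>"
      by (simp add: abs_mult)
    also have "\<dots> \<le> 2 * lp_norm p x * D"
      using leD abs_le_lp_norm[OF p x] by (intro mult_mono) (auto simp: lp_norm_nonneg)
    finally show ?thesis .
  qed
  then have "lp_continuous_linear p (lp_diagonal p ?d)"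
    by (rule lp_continuous_linear_diagonal[OF p])
  moreover have "limitin (lp_topology p)
      (\<lambda>u n. (Qpow m (\<lambda>k. x k + u k, y) n - Qpow m (x, y) n - lp_diagonal p ?d u n) / lp_norm p u)
      (\<lambda>_. 0) (atin (lp_topology p) (\<lambda>_. 0))"
  proof (rule limitin_quadratic_remainder[OF p])
    show "C * A\<^sup>2 + D \<ge> 0"
      using C D by simp
    fix u n assume u: "u \<in> lp p" and "lp_norm p u < 1"
    then have u1: "\<bar>u n\<bar> \<le> 1"
      using abs_le_lp_norm[OF p u, of n] by linarith
    define k where "k = 2 * x n * u n + (u n)\<^sup>2"
    have kA: "\<bar>k\<bar> \<le> A * \<bar>u n\<bar>"
    proof -
      have "\<bar>k\<bar> = \<bar>2 * x n + u n\<bar> * \<bar>u n\<bar>"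
        by (simp add: k_def power2_eq_square algebra_simps flip: abs_mult)
      also have "\<bar>2 * x n + u n\<bar> \<le> A"
        using u1 abs_le_lp_norm[OF p x, of n] unfolding A_def by linarith
      finally show ?thesis
        by (simp add: mult_right_mono)
    qed
    also have "\<dots> \<le> A"
      using mult_left_mono[OF u1 A] by simp
    finally have kB: "\<bar>k\<bar> \<le> ?B" by simp
    have zB: "\<bar>z n\<bar> \<le> ?B"
      using abs_le_lp_norm[OF p z, of n] by linarith
    let ?r = "(z n + k) ^ m - z n ^ m - real m * z n ^ (m - 1) * k"
    have "(x n + u n)\<^sup>2 + y n = z n + k"
      by (simp add: z_def k_def power2_sum)
    then have "Qpow m (\<lambda>k. x k + u k, y) n - Qpow m (x, y) n - lp_diagonal p ?d u n
        = (z n + k) ^ m - z n ^ m - ?d n * u n"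
      using u by (simp add: Qpow_def lp_diagonal_def z_def add_ac)
    also have "\<dots> = ?r + real m * z n ^ (m - 1) * (u n)\<^sup>2"
      by (simp add: k_def algebra_simps)
    also have "\<bar>\<dots>\<bar> \<le> \<bar>?r\<bar> + \<bar>real m * z n ^ (m - 1)\<bar> * (u n)\<^sup>2"
      by (rule order_trans[OF abs_triangle_ineq]) (simp add: abs_mult)
    also have "\<dots> \<le> C * k\<^sup>2 + D * (u n)\<^sup>2"
      by (intro add_mono le[OF zB kB] mult_right_mono leD) simp
    also have "\<dots> \<le> C * (A\<^sup>2 * (u n)\<^sup>2) + D * (u n)\<^sup>2"
      using power_mono[OF kA, of 2] C
      by (intro add_right_mono mult_left_mono) (simp_all add: power_mult_distrib)
    also have "\<dots> = (C * A\<^sup>2 + D) * (u n)\<^sup>2"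
      by (simp add: distrib_right)
    finally show "\<bar>Qpow m (\<lambda>k. x k + u k, y) n - Qpow m (x, y) n - lp_diagonal p ?d u n\<bar>
        \<le> (C * A\<^sup>2 + D) * (u n)\<^sup>2" .
  qed
  ultimately show ?thesis
    by (simp add: lp_has_partial1_def z_def)
qed

lemma lp_continuous_linear_diagonal_apply:
  assumes "lp_continuous_linear p (lp_diagonal p d)" "v \<in> lp p"
  shows "lp_diagonal p d v = (\<lambda>n. d n * v n)" "(\<lambda>n. d n * v n) \<in> lp p"
  using assms by (auto simp: lp_continuous_linear_def lp_diagonal_def dest: PiE_mem)

lemma Qpow_partials:
  assumes p: "p \<ge> 1" and x: "x \<in> lp p" and y: "y \<in> lp p"
  shows lp_nabla1_Qpow: "lp_nabla1 p (Qpow m) x y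
        = lp_diagonal p (\<lambda>n. 2 * real m * x n * ((x n)\<^sup>2 + y n) ^ (m - 1))"
    and lp_nabla2_Qpow: "lp_nabla2 p (Qpow m) x y
        = lp_diagonal p (\<lambda>n. real m * ((x n)\<^sup>2 + y n) ^ (m - 1))"
    and Qpow_partially_differentiable1: "lp_partially_differentiable1 p (Qpow m) x y"
    and Qpow_partially_differentiable2: "lp_partially_differentiable2 p (Qpow m) x y"
    and Qpow_continuous_linear1: "lp_continuous_linear p
        (lp_diagonal p (\<lambda>n. 2 * real m * x n * ((x n)\<^sup>2 + y n) ^ (m - 1)))"
    and Qpow_continuous_linear2: "lp_continuous_linear p
        (lp_diagonal p (\<lambda>n. real m * ((x n)\<^sup>2 + y n) ^ (m - 1)))"
  using Qpow_has_partial1[OF p x y] Qpow_has_partial2[OF p x y]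
    lp_nabla1_eqI[OF p Qpow_has_partial1[OF p x y]] lp_nabla2_eqI[OF p Qpow_has_partial2[OF p x y]]
  unfolding lp_has_partial1_def lp_has_partial2_def
    lp_partially_differentiable1_def lp_partially_differentiable2_def
  by blast+

theorem theorem3p1:
  fixes p :: real and m :: nat
  assumes "1 < p" and "m \<ge> 1"
  shows "Qpow m \<in> lp p \<times> lp p \<rightarrow> lp p
    \<and> (\<forall>x\<in>lp p. \<forall>y\<in>lp p. lp_partially_differentiable1 p (Qpow m) x y
                          \<and> lp_partially_differentiable2 p (Qpow m) x y)
    \<and> (\<forall>x\<in>lp p. \<forall>y\<in>lp p.
         (lp_nabla1 p (Qpow m) x y = lp_diagonal p (\<lambda>n. 2 * real m * x n * ((x n)\<^sup>2 + y n) ^ (m - 1))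
          \<and> lp_continuous_linear p (lp_nabla1 p (Qpow m) x y)
          \<and> (\<forall>v\<in>lp p. lp_nabla1 p (Qpow m) x y v
                         = (\<lambda>n. 2 * real m * x n * ((x n)\<^sup>2 + y n) ^ (m - 1) * v n)
                       \<and> (\<lambda>n. 2 * real m * x n * ((x n)\<^sup>2 + y n) ^ (m - 1) * v n) \<in> lp p))
       \<and> (lp_nabla2 p (Qpow m) x y = lp_diagonal p (\<lambda>n. real m * ((x n)\<^sup>2 + y n) ^ (m - 1))
          \<and> lp_continuous_linear p (lp_nabla2 p (Qpow m) x y)
          \<and> (\<forall>u\<in>lp p. lp_nabla2 p (Qpow m) x y u
                         = (\<lambda>n. real m * ((x n)\<^sup>2 + y n) ^ (m - 1) * u n)
                       \<and> (\<lambda>n. real m * ((x n)\<^sup>2 + y n) ^ (m - 1) * u n) \<in> lp p)))"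
proof -
  have p: "p \<ge> 1"
    using assms(1) by simp
  note continuous_linear = Qpow_continuous_linear1[OF p] Qpow_continuous_linear2[OF p]
  have maps: "Qpow m \<in> lp p \<times> lp p \<rightarrow> lp p"
    using Qpow_in_lp[OF p assms(2)] by auto
  show ?thesis
    by (intro conjI ballI maps)
      (simp_all only: Qpow_partially_differentiable1[OF p] Qpow_partially_differentiable2[OF p]
        lp_nabla1_Qpow[OF p] lp_nabla2_Qpow[OF p] continuous_linear
        continuous_linear[THEN lp_continuous_linear_diagonal_apply(1)]
        continuous_linear[THEN lp_continuous_linear_diagonal_apply(2)])
qed

end
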